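(* For every $n\in\mathbb{N}$, $n\ge 1$, and every prime number $p$, the Lusternik–Schnirelmann category of the moment angle complex of $K(\mathbb{F}_p^n)$ is $$\mathrm{cat}(\mathcal{Z}_{K(\mathbb{F}_p^n)})=\left[\frac n2\right].$$
   Context: $K(\mathbb{F}_p^n)$ is the simplicial complex whose vertices are the $1$-dimensional subspaces (lines) of $\mathbb{F}_p^n$ and whose simplices are the sets of lines $\{l_1,\dots,l_k\}$ spanning a $k$-dimensional subspace. For a simplicial complex $\mathcal{K}$ on $[m]$, the moment angle complex is $\mathcal{Z}_{\mathcal{K}}=\bigcup_{\sigma\in\mathcal{K}}\prod_{i=1}^mY_i^\sigma\subseteq(D^2)^m$, where $Y_i^\sigma=D^2$ if $i\in\sigma$ and $Y_i^\sigma=S^1=\partial D^2$ if $i\notin\sigma$. The Lusternik–Schnirelmann category $\mathrm{cat}(Y)$ of a space $Y$ is the smallest integer $k$ such that $Y$ admits a covering by $k+1$ open sets each contractible in $Y$. $[x]$ denotes the integer part (floor) of $x$. *)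

theory Defs
  imports
    "HOL-Analysis.Analysis"
    "HOL-Library.Extended_Nat"
    "Berlekamp_Zassenhaus.Finite_Field"
begin

definition lines :: "('k::field ^ 'n) set set" where
  "lines = {l. vec.subspace l \<and> vec.dim l = 1}"

text \<open>
  The complex \<open>K(\<bbbF>\<^sup>n)\<close>, as the set of its simplices. The empty simplex is included.
\<close>

definition line_complex :: "('k::field ^ 'n) set set set" where
  "line_complex =
     {\<sigma>. \<sigma> \<subseteq> lines \<and> finite \<sigma> \<and> vec.dim (vec.span (\<Union>\<sigma>)) = card \<sigma>}"

text \<open>
  The vertex set \<open>V\<close> takes the place of \<open>[m]\<close>: a point of \<open>(D\<^sup>2)\<^sup>m\<close> is a family indexed
  by \<open>V\<close>, with values in the closed unit disc of the complex plane.
\<close>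

definition moment_angle_complex :: "'v set \<Rightarrow> 'v set set \<Rightarrow> ('v \<Rightarrow> complex) topology" where
  "moment_angle_complex V K =
     subtopology (product_topology (\<lambda>_. euclidean) V)
       (\<Union>\<sigma>\<in>K. \<Pi>\<^sub>E v\<in>V. if v \<in> \<sigma> then cball 0 1 else sphere 0 1)"

definition contractible_in :: "'a topology \<Rightarrow> 'a set \<Rightarrow> bool" where
  "contractible_in Y U \<longleftrightarrow>
     U \<subseteq> topspace Y \<and>
     (\<exists>c. homotopic_with (\<lambda>_. True) (subtopology Y U) Y (\<lambda>x. x) (\<lambda>_. c))"

text \<open>
  Normalised so that contractible spaces have category 0; the value is \<open>\<infinity>\<close> if there is
  no finite categorical cover, since \<open>Inf {} = \<infinity>\<close>. The members of a cover need not be distinct,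
  which does not affect the minimum.
\<close>

definition LS_cat :: "'a topology \<Rightarrow> enat" where
  "LS_cat Y =
     Inf {enat k |k. \<exists>U :: nat \<Rightarrow> 'a set.
            (\<forall>i\<le>k. openin Y (U i) \<and> contractible_in Y (U i)) \<and>
            (\<Union>i\<le>k. U i) = topspace Y}"

end

theory Submission
  imports Defs
begin

text \<open>
  Upper bound: choose \<open>n div 2 + 1\<close> disjoint closed intervals in \<open>(0, 1)\<close>. A point of the
  moment angle complex has at most \<open>n\<close> coordinates inside the disc, so one of the intervals
  contains at most one of its moduli. On the open set belonging to that interval, pushing the
  larger moduli to \<open>1\<close> and moving the smaller coordinates to the point \<open>1\<close> is a homotopy into
  the part over the vertices, and this part is contracted one coordinate at a time, because any
  two lines span a simplex.

  Lower bound: \<open>k = n div 2\<close> independent planes, with three lines in each, give a copy of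
  \<open>(S\<^sup>5)\<^sup>k\<close> with coordinate projections onto the factors. With \<open>k\<close> categorical open sets,
  cut off the \<open>j\<close>-th contraction outside a closed part of the \<open>j\<close>-th set and apply it to the
  \<open>j\<close>-th factor, in polar coordinates and only for radii near \<open>1/2\<close>. The result is a self-map of
  Euclidean space at bounded distance from the identity that misses a point, against Brouwer's
  theorem.
\<close>

subsection \<open>Categorical covers of moment angle complexes\<close>

lemma topspace_moment_angle_complex:
  "x \<in> topspace (moment_angle_complex V K) \<longleftrightarrow>
     x \<in> extensional V \<and>
     (\<exists>\<sigma>\<in>K. \<forall>v\<in>V. norm (x v) \<le> 1 \<and> (v \<notin> \<sigma> \<longrightarrow> norm (x v) = 1))"
  unfolding moment_angle_complex_def
  by (fastforce simp: PiE_iff split: if_splits)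

lemma moment_angle_complexI:
  assumes "x \<in> extensional V" "\<sigma> \<in> K" "\<And>v. v \<in> V \<Longrightarrow> norm (x v) \<le> 1"
    and "\<And>v. v \<in> V \<Longrightarrow> norm (x v) \<noteq> 1 \<Longrightarrow> v \<in> \<sigma>"
  shows "x \<in> topspace (moment_angle_complex V K)"
  using assms by (auto simp: topspace_moment_angle_complex)

lemma moment_angle_complex_norm_le:
  "x \<in> topspace (moment_angle_complex V K) \<Longrightarrow> v \<in> V \<Longrightarrow> norm (x v) \<le> 1"
  by (auto simp: topspace_moment_angle_complex)

section \<open>Continuity and homotopy checked coordinate by coordinate\<close>

lemma continuous_map_into_moment_angle_complex:
  "continuous_map X (moment_angle_complex V K) f \<longleftrightarrow>
     f ` topspace X \<subseteq> topspace (moment_angle_complex V K) \<and>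
     (\<forall>v\<in>V. continuous_map X euclidean (\<lambda>x. f x v))"
proof -
  let ?S = "\<Union>\<sigma>\<in>K. \<Pi>\<^sub>E v\<in>V. if v \<in> \<sigma> then cball 0 1 else sphere 0 1 :: complex set"
  have top: "topspace (moment_angle_complex V K) = ?S"
    unfolding moment_angle_complex_def by (auto simp: PiE_iff)
  have "f ` topspace X \<subseteq> extensional V" if "f ` topspace X \<subseteq> ?S"
    using that by (fastforce simp: PiE_iff)
  then show ?thesis
    unfolding top
    unfolding moment_angle_complex_def continuous_map_in_subtopology continuous_map_componentwise
    by (simp add: image_subset_iff_funcset[symmetric]) blast
qed

lemma continuous_map_moment_angle_coordinate:
  assumes "v \<in> V"
  shows "continuous_map (moment_angle_complex V K) euclidean (\<lambda>x. x v)"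
  using assms continuous_map_into_moment_angle_complex[of "moment_angle_complex V K" V K "\<lambda>x. x"]
  by auto

lemma continuous_map_euclidean_compose2:
  assumes "continuous_map X euclidean f" "continuous_map X euclidean g"
    and "continuous_on UNIV (\<lambda>z. h (fst z) (snd z))"
  shows "continuous_map X euclidean (\<lambda>x. h (f x) (g x))"
proof -
  have "continuous_map X (prod_topology euclidean euclidean) (\<lambda>x. (f x, g x))"
    using assms(1,2) by (intro continuous_map_pairedI)
  then have "continuous_map X euclidean (\<lambda>x. (f x, g x))"
    by (simp add: prod_topology_euclidean)
  then have "continuous_map X euclidean ((\<lambda>z. h (fst z) (snd z)) \<circ> (\<lambda>x. (f x, g x)))"
    using assms(3) by (intro continuous_map_compose) auto
  then show ?thesis by (simp add: o_def)
qed

lemma continuous_map_homotopy_coordinate: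
  assumes "continuous_on UNIV (\<lambda>z. h (fst z) (snd z))" and "v \<in> V"
  shows "continuous_map (prod_topology (top_of_set {0..1::real}) (subtopology (moment_angle_complex V K) U))
           euclidean (\<lambda>(t, x). h t (x v))"
proof -
  have "continuous_map (prod_topology (top_of_set {0..1}) (subtopology (moment_angle_complex V K) U))
           euclidean (\<lambda>z. h (fst z) (snd z v))"
  proof (rule continuous_map_euclidean_compose2[OF _ _ assms(1)])
    have "continuous_map (subtopology (moment_angle_complex V K) U) euclidean (\<lambda>x. x v)"
      using continuous_map_moment_angle_coordinate[OF assms(2)]
      by (rule continuous_map_from_subtopology)
    then show "continuous_map (prod_topology (top_of_set {0..1}) (subtopology (moment_angle_complex V K) U))
           euclidean (\<lambda>z. snd z v)"
      using continuous_map_compose[OF continuous_map_snd] by (fastforce simp: o_def)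
    show "continuous_map (prod_topology (top_of_set {0..1}) (subtopology (moment_angle_complex V K) U))
           euclidean fst"
      using continuous_map_fst continuous_map_into_fulltopology by blast
  qed
  then show ?thesis by (simp add: case_prod_unfold)
qed

text \<open>Both homotopies of the upper bound move each coordinate by a function of the time and of
  that coordinate alone. Continuity then reduces to one function per vertex on the product of the
  line and the plane, and the only real obligation left is \<open>into\<close>, the simplex
  condition.\<close>

lemma homotopic_with_coordinatewise:
  fixes h :: "'v \<Rightarrow> real \<Rightarrow> complex \<Rightarrow> complex"
  assumes cont: "\<And>v. v \<in> V \<Longrightarrow> continuous_on UNIV (\<lambda>z. h v (fst z) (snd z))"
    and into: "\<And>t x. t \<in> {0..1} \<Longrightarrow> x \<in> topspace (moment_angle_complex V K) \<inter> U \<Longrightarrow>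
        (\<lambda>v\<in>V. h v t (x v)) \<in> topspace (moment_angle_complex V L)"
  shows "homotopic_with (\<lambda>_. True) (subtopology (moment_angle_complex V K) U) (moment_angle_complex V L)
    (\<lambda>x. \<lambda>v\<in>V. h v 0 (x v)) (\<lambda>x. \<lambda>v\<in>V. h v 1 (x v))"
proof -
  let ?H = "\<lambda>(t, x). \<lambda>v\<in>V. h v t (x v)"
  have "continuous_map (prod_topology (top_of_set {0..1}) (subtopology (moment_angle_complex V K) U))
          (moment_angle_complex V L) ?H"
    unfolding continuous_map_into_moment_angle_complex
  proof (intro conjI ballI)
    show "?H ` topspace (prod_topology (top_of_set {0..1}) (subtopology (moment_angle_complex V K) U))
        \<subseteq> topspace (moment_angle_complex V L)"
      using into by (auto simp: topspace_subtopology)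
    fix v assume "v \<in> V"
    then show "continuous_map (prod_topology (top_of_set {0..1}) (subtopology (moment_angle_complex V K) U))
         euclidean (\<lambda>x. ?H x v)"
      using continuous_map_homotopy_coordinate[OF cont \<open>v \<in> V\<close>] \<open>v \<in> V\<close>
      by (simp add: case_prod_unfold)
  qed
  then show ?thesis
    unfolding homotopic_with_def by (intro exI[of _ ?H]) auto
qed


section \<open>The upper bound, for complexes in which any two vertices span a simplex\<close>

lemma homotopic_with_moment_angle_points_const:
  assumes "finite V" and K: "\<And>\<sigma>. \<sigma> \<subseteq> V \<Longrightarrow> card \<sigma> \<le> 2 \<Longrightarrow> \<sigma> \<in> K"
  shows "homotopic_with (\<lambda>_. True) (moment_angle_complex V {\<sigma>. \<sigma> \<subseteq> V \<and> card \<sigma> \<le> 1})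
           (moment_angle_complex V K) (\<lambda>x. \<lambda>v\<in>V. x v) (\<lambda>x. \<lambda>v\<in>V. 1)"
proof -
  obtain e where e: "bij_betw e V {0..<card V}"
    using ex_bij_betw_finite_nat[OF \<open>finite V\<close>] by blast
  \<comment> \<open>The coordinates are moved to 1 along segments, one after another:
    \<open>\<tau> v\<close> is the clock of \<open>v\<close>, running from 0 to 1 while
    \<open>t * card V\<close> passes from \<open>e v\<close> to \<open>e v + 1\<close>. At every
    moment at most two coordinates are off the circle, the one that started there and the one in
    motion, and two vertices always form a simplex of \<open>K\<close>.\<close>
  define \<tau> :: "'a \<Rightarrow> real \<Rightarrow> real" where
    "\<tau> = (\<lambda>v t. min 1 (max 0 (t * real (card V) - real (e v))))"
  define h :: "'a \<Rightarrow> real \<Rightarrow> complex \<Rightarrow> complex" where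
    "h = (\<lambda>v t z. (1 - \<tau> v t) *\<^sub>R z + of_real (\<tau> v t))"
  have \<tau>: "0 \<le> \<tau> v t" "\<tau> v t \<le> 1" for v t
    by (auto simp: \<tau>_def)
  have le: "norm (h v t z) \<le> 1" if "norm z \<le> 1" for v t z
  proof -
    have "norm (h v t z) \<le> (1 - \<tau> v t) * norm z + \<tau> v t"
      unfolding h_def using \<tau>[of v t] by (intro norm_triangle_le) simp
    also have "\<dots> \<le> (1 - \<tau> v t) * 1 + \<tau> v t"
      using \<tau>[of v t] that by (intro add_right_mono mult_left_mono) auto
    finally show ?thesis by simp
  qed
  have "homotopic_with (\<lambda>_. True)
     (subtopology (moment_angle_complex V {\<sigma>. \<sigma> \<subseteq> V \<and> card \<sigma> \<le> 1}) UNIV) (moment_angle_complex V K)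
     (\<lambda>x. \<lambda>v\<in>V. h v 0 (x v)) (\<lambda>x. \<lambda>v\<in>V. h v 1 (x v))"
  proof (rule homotopic_with_coordinatewise)
    show "continuous_on UNIV (\<lambda>z. h v (fst z) (snd z))" for v
      unfolding h_def \<tau>_def by (intro continuous_intros)
    fix t :: real and x
    assume "t \<in> {0..1}"
      and "x \<in> topspace (moment_angle_complex V {\<sigma>. \<sigma> \<subseteq> V \<and> card \<sigma> \<le> 1}) \<inter> UNIV"
    then obtain \<sigma> where \<sigma>: "\<sigma> \<subseteq> V" "card \<sigma> \<le> 1"
      and x: "\<And>v. v \<in> V \<Longrightarrow> norm (x v) \<le> 1" "\<And>v. v \<in> V \<Longrightarrow> v \<notin> \<sigma> \<Longrightarrow> norm (x v) = 1"
      by (auto simp: topspace_moment_angle_complex)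
    \<comment> \<open>at time \<open>t\<close> only this vertex can be strictly between its start and its end\<close>
    define \<rho> where "\<rho> = {v \<in> V. e v = nat \<lfloor>t * card V\<rfloor>}"
    have "card \<rho> \<le> 1"
    proof (cases "\<rho> = {}")
      case False
      then obtain w where "w \<in> \<rho>" by auto
      then have "\<rho> = {w}" using e by (auto simp: \<rho>_def bij_betw_def inj_on_def)
      then show ?thesis by simp
    qed auto
    then have card: "card (\<sigma> \<union> \<rho>) \<le> 2"
      using card_Un_le[of \<sigma> \<rho>] \<sigma> by linarith
    show "(\<lambda>v\<in>V. h v t (x v)) \<in> topspace (moment_angle_complex V K)"
    proof (rule moment_angle_complexI)
      show "\<sigma> \<union> \<rho> \<in> K"
        using \<sigma> card by (intro K) (auto simp: \<rho>_def)
      show "norm ((\<lambda>v\<in>V. h v t (x v)) v) \<le> 1" if "v \<in> V" for v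
        using le x that by simp
      fix v assume v: "v \<in> V" and ne: "norm ((\<lambda>v\<in>V. h v t (x v)) v) \<noteq> 1"
      show "v \<in> \<sigma> \<union> \<rho>"
      proof (rule ccontr)
        assume nin: "v \<notin> \<sigma> \<union> \<rho>"
        then have "e v \<noteq> nat \<lfloor>t * card V\<rfloor>" using v by (simp add: \<rho>_def)
        moreover have "0 \<le> t * card V" using \<open>t \<in> {0..1}\<close> by simp
        ultimately have "t * card V \<le> e v \<or> e v + 1 \<le> t * card V"
          by linarith
        then have "\<tau> v t = 0 \<or> \<tau> v t = 1" by (auto simp: \<tau>_def)
        then have "h v t (x v) = x v \<or> h v t (x v) = 1" by (auto simp: h_def)
        with ne v x(2)[of v] nin show False by auto
      qed
    qed simp
  qed
  moreover have "h v 0 z = z" for v z by (simp add: h_def \<tau>_def)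
  moreover have "h v 1 z = 1" if "v \<in> V" for v z
  proof -
    have "real (e v) + 1 \<le> card V"
      using bij_betwE[OF e] that by fastforce
    then show ?thesis by (simp add: h_def \<tau>_def)
  qed
  ultimately show ?thesis by (simp cong: restrict_cong)
qed

text \<open>A self-map \<open>\<phi>\<close> of the disc, fixing the circle pointwise, sends
  everything outside the band of moduli between \<open>lo\<close> and \<open>hi\<close> to the
  circle. Since at most one modulus of a point of \<open>U\<close> lies in the band, applying
  \<open>\<phi>\<close> to all coordinates lands in the part over the vertices, which is already
  known to contract.\<close>

lemma contractible_in_moment_angle_gap:
  fixes lo hi :: real
  assumes "finite V" and K: "\<And>\<sigma>. \<sigma> \<subseteq> V \<Longrightarrow> card \<sigma> \<le> 2 \<Longrightarrow> \<sigma> \<in> K"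
    and lohi: "0 < lo" "lo < hi" "hi < 1"
    and U: "U \<subseteq> topspace (moment_angle_complex V K)"
    and gap: "\<And>x u v. x \<in> U \<Longrightarrow> u \<in> V \<Longrightarrow> v \<in> V \<Longrightarrow> norm (x u) \<in> {lo..hi} \<Longrightarrow>
                norm (x v) \<in> {lo..hi} \<Longrightarrow> u = v"
  shows "contractible_in (moment_angle_complex V K) U"
proof -
  let ?L = "{\<sigma>. \<sigma> \<subseteq> V \<and> card \<sigma> \<le> 1}"
  define m where "m = (lo + hi) / 2"
  have m: "0 < m" "lo < m" "m < hi" using lohi by (auto simp: m_def)
  \<comment> \<open>Both summands vanish at modulus \<open>m\<close>. Going outwards from there, the
    radial projection is scaled up to full length at \<open>hi\<close>; going inwards, a real value
    rises to 1 at \<open>lo\<close>. The \<open>max m\<close> in the denominator keeps the formula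
    continuous at the origin, where its factor is 0 anyway.\<close>
  define \<phi> :: "complex \<Rightarrow> complex" where
    "\<phi> = (\<lambda>z. min 1 (max 0 ((norm z - m) / (hi - m))) *\<^sub>R (z /\<^sub>R max m (norm z))
            + of_real (min 1 (max 0 ((m - norm z) / (m - lo)))))"
  have \<phi>_lo: "\<phi> z = 1" if "norm z \<le> lo" for z
  proof -
    have "(norm z - m) / (hi - m) \<le> 0" using that m by (simp add: divide_nonpos_pos)
    moreover have "(m - norm z) / (m - lo) \<ge> 1" using that m by simp
    ultimately show ?thesis by (simp add: \<phi>_def)
  qed
  have \<phi>_hi: "\<phi> z = z /\<^sub>R norm z" if "norm z \<ge> hi" for z
  proof -
    have "(m - norm z) / (m - lo) \<le> 0" using that m by (simp add: divide_nonpos_pos)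
    moreover have "(norm z - m) / (hi - m) \<ge> 1" using that m by simp
    ultimately show ?thesis using that m by (simp add: \<phi>_def max_def)
  qed
  have \<phi>_le: "norm (\<phi> z) \<le> 1" for z
  proof (cases "norm z \<le> m")
    case True
    then have "(norm z - m) / (hi - m) \<le> 0" using m by (simp add: divide_nonpos_pos)
    then show ?thesis by (simp add: \<phi>_def)
  next
    case False
    then have "(m - norm z) / (m - lo) \<le> 0" using m by (simp add: divide_nonpos_pos)
    then have "\<phi> z = min 1 ((norm z - m) / (hi - m)) *\<^sub>R (z /\<^sub>R norm z)"
      using False m by (simp add: \<phi>_def max_def)
    moreover have "z \<noteq> 0" using False m by auto
    then have "norm (z /\<^sub>R norm z) = 1" by simp
    ultimately show ?thesis using False m by (simp only: norm_scaleR) auto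
  qed
  have \<phi>_circle: "norm (\<phi> z) = 1" if "norm z \<notin> {lo..hi}" for z
  proof (cases "norm z \<le> lo")
    case False
    then have "norm z \<ge> hi" "z \<noteq> 0" using that lohi by auto
    then show ?thesis using \<phi>_hi[of z] by simp
  qed (simp add: \<phi>_lo)
  have \<phi>_id: "\<phi> z = z" if "norm z = 1" for z
    using \<phi>_hi[of z] that lohi by simp
  have \<phi>_cont: "continuous_on UNIV \<phi>"
    unfolding \<phi>_def using m by (intro continuous_intros) (auto simp: max_def)
  define h :: "'a \<Rightarrow> real \<Rightarrow> complex \<Rightarrow> complex" where
    "h = (\<lambda>v t z. (1 - t) *\<^sub>R z + t *\<^sub>R \<phi> z)"
  have hom1: "homotopic_with (\<lambda>_. True) (subtopology (moment_angle_complex V K) U)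
      (moment_angle_complex V K) (\<lambda>x. \<lambda>v\<in>V. h v 0 (x v)) (\<lambda>x. \<lambda>v\<in>V. h v 1 (x v))"
  \<comment> \<open>The linear homotopy from the identity to \<open>\<phi>\<close> fixes the circle,
    so a point never leaves the cell of its simplex \<open>\<sigma>\<close>.\<close>
  proof (rule homotopic_with_coordinatewise)
    show "continuous_on UNIV (\<lambda>z. h v (fst z) (snd z))" for v
      unfolding h_def by (intro continuous_intros continuous_on_compose2[OF \<phi>_cont]) auto
    fix t :: real and x
    assume t: "t \<in> {0..1}" and "x \<in> topspace (moment_angle_complex V K) \<inter> U"
    then obtain \<sigma> where \<sigma>: "\<sigma> \<in> K"
      and x: "\<And>v. v \<in> V \<Longrightarrow> norm (x v) \<le> 1" "\<And>v. v \<in> V \<Longrightarrow> v \<notin> \<sigma> \<Longrightarrow> norm (x v) = 1"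
      by (auto simp: topspace_moment_angle_complex)
    show "(\<lambda>v\<in>V. h v t (x v)) \<in> topspace (moment_angle_complex V K)"
    proof (rule moment_angle_complexI[OF _ \<sigma>])
      show "norm ((\<lambda>v\<in>V. h v t (x v)) v) \<le> 1" if "v \<in> V" for v
      proof -
        have "norm (h v t (x v)) \<le> (1 - t) * norm (x v) + t * norm (\<phi> (x v))"
          unfolding h_def using t by (intro norm_triangle_le) simp
        also have "\<dots> \<le> (1 - t) * 1 + t * 1"
          using t x that \<phi>_le by (intro add_mono mult_left_mono) auto
        finally show ?thesis using that by simp
      qed
      show "v \<in> \<sigma>" if "v \<in> V" "norm ((\<lambda>v\<in>V. h v t (x v)) v) \<noteq> 1" for v
      proof (rule ccontr)
        assume "v \<notin> \<sigma>"
        then have "norm (x v) = 1" using x that by blast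
        then have "h v t (x v) = x v"
          by (simp add: h_def \<phi>_id scaleR_left_diff_distrib)
        then show False using \<open>norm (x v) = 1\<close> that by simp
      qed
    qed simp
  qed
  have "continuous_map (subtopology (moment_angle_complex V K) U) (moment_angle_complex V ?L)
      (\<lambda>x. \<lambda>v\<in>V. \<phi> (x v))"
    unfolding continuous_map_into_moment_angle_complex
  proof (intro conjI ballI image_subsetI)
    fix x assume "x \<in> topspace (subtopology (moment_angle_complex V K) U)"
    then have "x \<in> U" by simp
    show "(\<lambda>v\<in>V. \<phi> (x v)) \<in> topspace (moment_angle_complex V ?L)"
    proof (rule moment_angle_complexI)
      let ?\<sigma> = "{v \<in> V. norm (x v) \<in> {lo..hi}}"
      have "card ?\<sigma> \<le> 1"
      proof (cases "?\<sigma> = {}")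
        case False
        then obtain w where "w \<in> ?\<sigma>" by auto
        then have "?\<sigma> = {w}" using gap[OF \<open>x \<in> U\<close>] by auto
        then show ?thesis by simp
      next
        case True
        then show ?thesis by (metis card.empty zero_le)
      qed
      then show "?\<sigma> \<in> ?L" by auto
      show "v \<in> ?\<sigma>" if "v \<in> V" "norm ((\<lambda>v\<in>V. \<phi> (x v)) v) \<noteq> 1" for v
        using that \<phi>_circle[of "x v"] by auto
    qed (auto simp: \<phi>_le)
  next
    fix v assume v: "v \<in> V"
    have "continuous_map (moment_angle_complex V K) euclidean (\<phi> \<circ> (\<lambda>x. x v))"
      using continuous_map_moment_angle_coordinate[OF v] \<phi>_cont
      by (intro continuous_map_compose) auto
    then show "continuous_map (subtopology (moment_angle_complex V K) U) euclidean
        (\<lambda>x. (\<lambda>v\<in>V. \<phi> (x v)) v)"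
      using v by (simp add: o_def continuous_map_from_subtopology)
  qed
  from homotopic_with_compose_continuous_map_right
    [OF homotopic_with_moment_angle_points_const[OF \<open>finite V\<close> K] this]
  have hom2: "homotopic_with (\<lambda>_. True) (subtopology (moment_angle_complex V K) U)
      (moment_angle_complex V K) (\<lambda>x. \<lambda>v\<in>V. \<phi> (x v)) (\<lambda>x. \<lambda>v\<in>V. 1)"
    by (simp add: o_def cong: restrict_cong)
  have "(\<lambda>x. \<lambda>v\<in>V. h v 1 (x v)) = (\<lambda>x. \<lambda>v\<in>V. \<phi> (x v))"
    by (simp add: h_def)
  with homotopic_with_trans[OF hom1] hom2
  have "homotopic_with (\<lambda>_. True) (subtopology (moment_angle_complex V K) U)
      (moment_angle_complex V K) (\<lambda>x. \<lambda>v\<in>V. x v) (\<lambda>x. \<lambda>v\<in>V. 1)"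
    by (simp add: h_def)
  moreover have "(\<lambda>v\<in>V. x v) = x" if "x \<in> topspace (subtopology (moment_angle_complex V K) U)" for x
    using that by (simp add: topspace_moment_angle_complex extensional_restrict)
  ultimately have "homotopic_with (\<lambda>_. True) (subtopology (moment_angle_complex V K) U)
      (moment_angle_complex V K) (\<lambda>x. x) (\<lambda>x. \<lambda>v\<in>V. 1)"
    by (auto elim!: homotopic_with_eq)
  then show ?thesis
    using U unfolding contractible_in_def by blast
qed

lemma LS_cat_le:
  assumes "\<And>i. i \<le> k \<Longrightarrow> openin Y (U i)" "\<And>i. i \<le> k \<Longrightarrow> contractible_in Y (U i)"
    and "(\<Union>i\<le>k. U i) = topspace Y"
  shows "LS_cat Y \<le> enat k"
  unfolding LS_cat_def using assms by (intro Inf_lower) auto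

lemma LS_cat_moment_angle_complex_le:
  assumes "finite V" and K: "\<And>\<sigma>. \<sigma> \<subseteq> V \<Longrightarrow> card \<sigma> \<le> 2 \<Longrightarrow> \<sigma> \<in> K"
    and dim: "\<And>\<sigma>. \<sigma> \<in> K \<Longrightarrow> finite \<sigma> \<and> card \<sigma> \<le> n"
  shows "LS_cat (moment_angle_complex V K) \<le> enat (n div 2)"
proof -
  let ?Z = "moment_angle_complex V K"
  define k where "k = n div 2"
  \<comment> \<open>The \<open>2 * k + 2\<close> interior points of the division of the unit
    interval into \<open>2 * k + 3\<close> equal parts, taken in consecutive pairs, bound
    \<open>k + 1\<close> disjoint closed intervals away from 0 and 1.\<close>
  define lo :: "nat \<Rightarrow> real" where "lo = (\<lambda>j. (2 * j + 1) / (2 * k + 3))"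
  define hi :: "nat \<Rightarrow> real" where "hi = (\<lambda>j. (2 * j + 2) / (2 * k + 3))"
  define U where "U = (\<lambda>j. {x \<in> topspace ?Z. \<forall>u\<in>V. \<forall>v\<in>V. u \<noteq> v \<longrightarrow>
      \<not> (norm (x u) \<in> {lo j..hi j} \<and> norm (x v) \<in> {lo j..hi j})})"
  have lohi: "0 < lo j" "lo j < hi j" for j
    by (auto simp: lo_def hi_def divide_strict_right_mono)
  have hi1: "hi j < 1" if "j \<le> k" for j
    using that by (simp add: hi_def divide_simps)
  have hilo: "hi i < lo j" if "i < j" for i j
    using that by (simp add: lo_def hi_def divide_strict_right_mono)
  show ?thesis
    unfolding k_def[symmetric]
  proof (rule LS_cat_le)
    show "contractible_in ?Z (U j)" if "j \<le> k" for j
      using assms lohi hi1[OF that]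
      by (intro contractible_in_moment_angle_gap[where lo = "lo j" and hi = "hi j"])
         (auto simp: U_def)
    show "openin ?Z (U j)" for j
    proof -
      \<comment> \<open>\<open>U j\<close> is a finite intersection, over pairs of distinct
        vertices, of unions of two open sets. Intersecting with the whole space takes care of an
        empty \<open>P\<close>.\<close>
      define P where "P = {(u, v). u \<in> V \<and> v \<in> V \<and> u \<noteq> v}"
      have "finite P"
        using \<open>finite V\<close> by (rule_tac finite_subset[of _ "V \<times> V"]) (auto simp: P_def)
      have "openin ?Z {x \<in> topspace ?Z. norm (x u) \<in> - {lo j..hi j}}" if "u \<in> V" for u
      proof (rule openin_continuous_map_preimage)
        show "continuous_map ?Z euclidean (\<lambda>x. norm (x u))"
          using continuous_map_moment_angle_coordinate[OF that]
          by (intro continuous_map_norm)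
      qed auto
      then have "openin ?Z ({x \<in> topspace ?Z. norm (x u) \<in> - {lo j..hi j}} \<union>
          {x \<in> topspace ?Z. norm (x v) \<in> - {lo j..hi j}})" if "(u, v) \<in> P" for u v
        using that by (intro openin_Un) (auto simp: P_def)
      then have "openin ?Z ((\<Inter>p\<in>P. {x \<in> topspace ?Z. norm (x (fst p)) \<in> - {lo j..hi j}} \<union>
          {x \<in> topspace ?Z. norm (x (snd p)) \<in> - {lo j..hi j}}) \<inter> topspace ?Z)"
        using \<open>finite P\<close> by (intro openin_INT) auto
      also have "\<dots> = U j"
        by (auto simp: U_def P_def)
      finally show ?thesis .
    qed
    have "\<exists>j\<le>k. x \<in> U j" if x: "x \<in> topspace ?Z" for x
    proof (rule ccontr)
      \<comment> \<open>otherwise each of the \<open>k + 1\<close> disjoint intervals contains two of the at most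
        \<open>n < 2 * k + 2\<close> moduli below \<open>1\<close>\<close>
      assume "\<not> (\<exists>j\<le>k. x \<in> U j)"
      define N where "N = (\<lambda>j. {v \<in> V. norm (x v) \<in> {lo j..hi j}})"
      have N2: "2 \<le> card (N j)" if "j \<le> k" for j
      proof -
        have "x \<notin> U j" using \<open>\<not> (\<exists>j\<le>k. x \<in> U j)\<close> that by blast
        then obtain u v where "{u, v} \<subseteq> N j" "u \<noteq> v"
          using x by (auto simp: U_def N_def)
        moreover have "finite (N j)" using \<open>finite V\<close> by (simp add: N_def)
        ultimately show ?thesis using card_mono[of "N j" "{u, v}"] by simp
      qed
      from x obtain \<sigma> where \<sigma>: "\<sigma> \<in> K" and bd: "\<And>v. v \<in> V \<Longrightarrow> v \<notin> \<sigma> \<Longrightarrow> norm (x v) = 1"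
        by (auto simp: topspace_moment_angle_complex)
      have "2 * (k + 1) = (\<Sum>j\<le>k. 2)" by simp
      also have "\<dots> \<le> (\<Sum>j\<le>k. card (N j))" using N2 by (intro sum_mono) auto
      also have "\<dots> = card (\<Union>j\<le>k. N j)"
      proof (rule card_UN_disjoint[symmetric])
        show "\<forall>i\<in>{..k}. \<forall>j\<in>{..k}. i \<noteq> j \<longrightarrow> N i \<inter> N j = {}"
        proof (intro ballI impI)
          fix i j :: nat assume "i \<noteq> j"
          then have "hi i < lo j \<or> hi j < lo i" using hilo by (meson linorder_neqE_nat)
          then show "N i \<inter> N j = {}" by (auto simp: N_def)
        qed
      qed (use \<open>finite V\<close> in \<open>auto simp: N_def\<close>)
      also have "\<dots> \<le> card \<sigma>"
      proof (rule card_mono)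
        show "(\<Union>j\<le>k. N j) \<subseteq> \<sigma>"
          using bd hi1 by (force simp: N_def)
      qed (use dim \<sigma> in blast)
      also have "\<dots> \<le> n" using dim \<sigma> by blast
      finally show False by (simp add: k_def)
    qed
    moreover have "U j \<subseteq> topspace ?Z" for j by (auto simp: U_def)
    ultimately show "(\<Union>j\<le>k. U j) = topspace ?Z" by blast
  qed
qed

subsection \<open>Joins of boundaries of simplices\<close>

lemma continuous_on_Max_image:
  fixes f :: "'i \<Rightarrow> 'a::topological_space \<Rightarrow> 'b::linorder_topology"
  assumes "finite I" "I \<noteq> {}" "\<And>i. i \<in> I \<Longrightarrow> continuous_on S (f i)"
  shows "continuous_on S (\<lambda>x. Max ((\<lambda>i. f i x) ` I))"
  using assms
proof (induction rule: finite_ne_induct)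
  case (insert i I)
  then have "continuous_on S (\<lambda>x. max (f i x) (Max ((\<lambda>i. f i x) ` I)))"
    by (intro continuous_on_max) auto
  then show ?case using insert by simp
qed simp

text \<open>Together with the bound 1 on all moduli, this says that the projection to the
  coordinates in \<open>B\<close> lands in the boundary of the polydisc, which is a sphere.\<close>

lemma moment_angle_complex_nonface:
  assumes "x \<in> topspace (moment_angle_complex V K)" "B \<subseteq> V" "\<And>\<sigma>. \<sigma> \<in> K \<Longrightarrow> \<not> B \<subseteq> \<sigma>"
  shows "\<exists>i\<in>B. norm (x i) = 1"
  using assms by (fastforce simp: topspace_moment_angle_complex)

text \<open>The map sending \<open>x\<close> to \<open>y + (x - f x)\<close> takes values in the
  ball of radius \<open>norm y + C\<close>. By Brouwer it has a fixed point there, and a fixed point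
  is a solution of \<open>f x = y\<close>.\<close>

lemma bounded_displacement_surjective:
  fixes f :: "'a::euclidean_space \<Rightarrow> 'a"
  assumes "continuous_on UNIV f" "\<And>x. norm (x - f x) \<le> C"
  shows "surj f"
proof -
  have "\<exists>x\<in>cball 0 (norm y + C). f x = y" for y
  proof (rule brouwer_surjective[where S = "{y}"])
    show "x + (z - f z) \<in> cball 0 (norm y + C)" if "x \<in> {y}" for x z
      using that assms(2)[of z] norm_triangle_ineq[of y "z - f z"] by simp
    show "cball 0 (norm y + C) \<noteq> {}"
      using order_trans[OF norm_ge_zero assms(2)[of 0]] norm_ge_zero[of y]
      by (simp add: cball_eq_empty not_less add_nonneg_nonneg)
  qed (use assms(1) continuous_on_subset in \<open>auto\<close>)
  then have "\<exists>x. y = f x" for y by metis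
  then show ?thesis by (simp add: surj_def)
qed

text \<open>By \<open>nonface\<close> and \<open>face\<close>, the full subcomplex on the union of
  the blocks \<open>B j\<close> is the join of the boundaries of \<open>m\<close> simplices, and its
  moment angle complex is a product of \<open>m\<close> spheres. The number of open sets equals the
  number of blocks, so each contraction can be given a block of its own.\<close>

lemma moment_angle_complex_no_small_cover:
  fixes V :: "'v::finite set" and B :: "nat \<Rightarrow> 'v set"
  assumes m: "0 < m"
    and B: "\<And>j. j < m \<Longrightarrow> B j \<noteq> {}" "\<And>j. j < m \<Longrightarrow> B j \<subseteq> V"
    and disj: "\<And>i j. i < m \<Longrightarrow> j < m \<Longrightarrow> i \<noteq> j \<Longrightarrow> B i \<inter> B j = {}"
    and nonface: "\<And>j \<sigma>. j < m \<Longrightarrow> \<sigma> \<in> K \<Longrightarrow> \<not> B j \<subseteq> \<sigma>"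
    and face: "\<And>\<sigma>. \<sigma> \<subseteq> (\<Union>j<m. B j) \<Longrightarrow> (\<And>j. j < m \<Longrightarrow> \<not> B j \<subseteq> \<sigma>) \<Longrightarrow> \<sigma> \<in> K"
    and U: "\<And>j. j < m \<Longrightarrow> openin (moment_angle_complex V K) (U j)"
      "\<And>j. j < m \<Longrightarrow> contractible_in (moment_angle_complex V K) (U j)"
  shows "(\<Union>j<m. U j) \<noteq> topspace (moment_angle_complex V K)"
proof
  let ?Z = "moment_angle_complex V K"
  assume cover: "(\<Union>j<m. U j) = topspace ?Z"
  define W where "W = (\<Union>j<m. B j)"
  define b where "b = (\<lambda>i. SOME j. j < m \<and> i \<in> B j)"
  have b_eq: "b i = j" if "j < m" "i \<in> B j" for i j
    using someI[of "\<lambda>j. j < m \<and> i \<in> B j" j] that disj[of j "b i"] by (auto simp: b_def)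
  have WE: "b i < m" "i \<in> B (b i)" if "i \<in> W" for i
    using that b_eq by (auto simp: W_def)
  have WV: "W \<subseteq> V" using B by (auto simp: W_def)
  \<comment> \<open>The radius of block \<open>j\<close> is its maximum norm, because the unit
    sphere of this norm is the boundary of the polydisc.\<close>
  define r :: "nat \<Rightarrow> complex^'v \<Rightarrow> real" where "r = (\<lambda>j v. Max ((\<lambda>i. norm (v $ i)) ` B j))"
  have r_cont: "continuous_on S (r j)" if "j < m" for S j
    unfolding r_def using B that by (intro continuous_on_Max_image continuous_intros) auto
  have r_ge: "norm (v $ i) \<le> r j v" if "i \<in> B j" for i j v
    unfolding r_def using that by (intro Max_ge) auto
  have r_eqI: "r j v = c" if "j < m" "\<And>i. i \<in> B j \<Longrightarrow> norm (v $ i) \<le> c" "\<exists>i\<in>B j. norm (v $ i) = c"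
    for j v c
    unfolding r_def using that by (intro Max_eqI) auto
  have r_att: "\<exists>i\<in>B j. norm (v $ i) = r j v" if "j < m" for j v
  proof -
    have "r j v \<in> (\<lambda>i. norm (v $ i)) ` B j"
      unfolding r_def using B(1)[OF that] by (intro Max_in) auto
    then show ?thesis by (metis imageE)
  qed
  define P where "P = {v. \<forall>j<m. 0 < r j v}"
  have "open P"
  proof -
    have "P = (\<Inter>j<m. {v. 0 < r j v})" by (auto simp: P_def)
    moreover have "open {v. 0 < r j v}" if "j < m" for j
      using r_cont[OF that] by (intro open_Collect_less continuous_intros) auto
    ultimately show ?thesis by (simp add: open_INT)
  qed
  \<comment> \<open>The angular part of the polar coordinates, with values in the product of
    spheres; the coordinates outside the blocks are frozen at 1.\<close>
  define \<theta> where "\<theta> = (\<lambda>v. \<lambda>i\<in>V. if i \<in> W then v $ i /\<^sub>R r (b i) v else 1)"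
  have \<theta>_in: "\<theta> v \<in> topspace ?Z" if "v \<in> P" for v
  proof (rule moment_angle_complexI)
    \<comment> \<open>In each block some coordinate attains the radius and is rescaled to modulus 1,
      so the others do not fill the block.\<close>
    let ?\<sigma> = "{i \<in> W. norm (v $ i) \<noteq> r (b i) v}"
    show "?\<sigma> \<in> K"
    proof (rule face)
      show "\<not> B j \<subseteq> ?\<sigma>" if "j < m" for j
        using r_att[OF that, of v] b_eq[OF that] by auto
    qed (auto simp: W_def)
    have pos: "0 < r (b i) v" if "i \<in> W" for i
      using WE[OF that] \<open>v \<in> P\<close> by (simp add: P_def)
    show "norm (\<theta> v i) \<le> 1" if "i \<in> V" for i
      using that pos[of i] r_ge[of i "b i" v] WE(2)[of i] by (auto simp: \<theta>_def field_simps)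
    show "i \<in> ?\<sigma>" if "i \<in> V" "norm (\<theta> v i) \<noteq> 1" for i
      using that pos[of i] by (auto simp: \<theta>_def split: if_splits)
  qed (simp add: \<theta>_def)
  have r\<theta>: "r (b i) v *\<^sub>R \<theta> v i = v $ i" if "v \<in> P" "i \<in> W" for v i
  proof -
    have "0 < r (b i) v" using that WE by (simp add: P_def)
    then show ?thesis using that WV by (auto simp: \<theta>_def)
  qed
  have \<theta>_cont: "continuous_map (top_of_set P) ?Z \<theta>"
    unfolding continuous_map_into_moment_angle_complex
  proof (intro conjI ballI)
    fix i assume "i \<in> V"
    have "continuous_on P (\<lambda>v. v $ i /\<^sub>R r (b i) v)" if "i \<in> W"
      using WE[OF that] by (intro continuous_intros r_cont) (auto simp: P_def)
    then show "continuous_map (top_of_set P) euclidean (\<lambda>v. \<theta> v i)"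
      using \<open>i \<in> V\<close> by (auto simp: \<theta>_def)
  qed (use \<theta>_in in auto)
  define Q where "Q = (\<lambda>j. {v \<in> P. \<theta> v \<in> U j})"
  have Q_open: "open (Q j)" if "j < m" for j
    using openin_continuous_map_preimage[OF \<theta>_cont U(1)[OF that]] \<open>open P\<close>
    by (simp add: Q_def openin_open_eq)
  have Q_cover: "\<exists>j<m. v \<in> Q j" if "v \<in> P" for v
    using \<theta>_in[OF that] cover that by (auto simp: Q_def)
  \<comment> \<open>\<open>infdist\<close> to the empty set is 0, so for \<open>d j\<close> to be
    positive on \<open>Q j\<close> the complement of \<open>Q j\<close> must have a point. The
    origin is one.\<close>
  have "0 \<notin> P"
  proof -
    have "r 0 0 = 0" using m B(1)[OF m] by (intro r_eqI) auto
    then show ?thesis using m by (auto simp: P_def)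
  qed
  define d where "d = (\<lambda>j v. infdist v (- Q j))"
  have d_pos: "0 < d j v \<longleftrightarrow> v \<in> Q j" if "j < m" for j v
  proof -
    have "- Q j \<noteq> {}" using \<open>0 \<notin> P\<close> by (auto simp: Q_def)
    then show ?thesis
      using Q_open[OF that] in_closed_iff_infdist_zero[of "- Q j" v] infdist_nonneg[of v "- Q j"]
      by (auto simp: d_def less_le)
  qed
  have d_nonneg: "0 \<le> d j v" for j v by (simp add: d_def infdist_nonneg)
  have d_cont: "continuous_on S (d j)" for S j
    unfolding d_def by (intro continuous_intros)
  define D where "D = (\<lambda>v. \<Sum>j<m. d j v)"
  have D_pos: "0 < D v" if "v \<in> P" for v
    using Q_cover[OF that] d_pos d_nonneg unfolding D_def by (auto intro!: sum_pos2)
  have D_cont: "continuous_on S D" for S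
    unfolding D_def by (intro continuous_intros d_cont)
  \<comment> \<open>\<open>\<mu> j\<close> is 1 where \<open>d j\<close> is at least the average
    \<open>D / m\<close>, which happens for some \<open>j\<close> at each point of \<open>P\<close>.
    It vanishes where \<open>d j\<close> is at most half the average, so the contraction is switched
    off before the boundary of \<open>Q j\<close> is reached.\<close>
  define \<mu> where "\<mu> = (\<lambda>j v. min 1 (max 0 (2 * m * d j v / D v - 1)))"
  have \<mu>_cont: "continuous_on P (\<mu> j)" for j
    unfolding \<mu>_def using D_pos by (intro continuous_intros d_cont D_cont) force
  have \<mu>_one: "\<exists>j<m. \<mu> j v = 1" if "v \<in> P" for v
  proof (rule ccontr)
    assume "\<not> (\<exists>j<m. \<mu> j v = 1)"
    moreover have "\<mu> j v = 1" if "D v \<le> m * d j v" for j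
    proof -
      have "1 \<le> 2 * m * d j v / D v - 1"
        using that D_pos[OF \<open>v \<in> P\<close>] by (simp add: field_simps)
      then show ?thesis by (simp add: \<mu>_def)
    qed
    ultimately have "m * d j v < D v" if "j < m" for j
      using that by (meson not_le)
    then have "(\<Sum>j<m. m * d j v) < (\<Sum>j<m. D v)"
      using m by (intro sum_strict_mono) auto
    then show False
      by (simp add: D_def sum_distrib_left)
  qed
  \<comment> \<open>Each factor is a tent over the radius, 1 at 1/2 and 0 outside the interval from
    1/4 to 3/4. Small radii are excluded for continuity off \<open>P\<close>, large ones for bounded
    displacement.\<close>
  define s where "s = (\<lambda>v. \<Prod>j<m. max 0 (1 - \<bar>4 * r j v - 2\<bar>))"
  have s_cont: "continuous_on S s" for S
    unfolding s_def by (intro continuous_intros r_cont) auto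
  have s01: "s v \<in> {0..1}" for v
    unfolding s_def by (auto intro!: prod_nonneg prod_le_1)
  have s_0: "s v = 0" if "j < m" "r j v \<le> 1/4 \<or> 1 \<le> r j v" for j v
    using that by (auto simp: s_def intro!: bexI[of _ j])
  define \<tau> where "\<tau> = (\<lambda>j v. s v * \<mu> j v)"
  have \<tau>01: "\<tau> j v \<in> {0..1}" for j v
    using s01[of v] by (auto simp: \<tau>_def \<mu>_def mult_le_one)
  have \<tau>_cont: "continuous_on P (\<tau> j)" for j
    unfolding \<tau>_def by (intro continuous_intros s_cont \<mu>_cont)
  have "topspace ?Z \<noteq> {}"
  proof -
    have "(\<chi> i. 1) \<in> P"
      using B r_eqI[of _ "\<chi> i. 1" 1] by (fastforce simp: P_def)
    then show ?thesis using \<theta>_in by blast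
  qed
  define contraction where "contraction = (\<lambda>j h c. c \<in> topspace ?Z \<and>
      continuous_map (prod_topology (top_of_set {0..1::real}) (subtopology ?Z (U j))) ?Z h \<and>
      (\<forall>x. h (0, x) = x) \<and> (\<forall>x\<in>U j. h (1, x) = c))"
  have "\<exists>h c. contraction j h c" if "j < m" for j
  proof -
    from U(2)[OF that] obtain h c where
      h: "continuous_map (prod_topology (top_of_set {0..1::real}) (subtopology ?Z (U j))) ?Z h"
        "\<forall>x. h (0, x) = x" "\<forall>x. h (1, x) = c" and sub: "U j \<subseteq> topspace ?Z"
      by (auto simp: contractible_in_def homotopic_with_def)
    \<comment> \<open>For empty \<open>U j\<close> the constant in \<open>contractible_in\<close> is
      arbitrary, so it is then replaced by a point of the space.\<close>
    have "c \<in> topspace ?Z" if "x \<in> U j" for x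
    proof -
      have "h (1, x) \<in> topspace ?Z"
        using that sub
        by (intro subsetD[OF continuous_map_image_subset_topspace[OF h(1)]] imageI) auto
      then show ?thesis using h(3) by simp
    qed
    then obtain c' where "c' \<in> topspace ?Z" "U j \<noteq> {} \<longrightarrow> c' = c"
      using \<open>topspace ?Z \<noteq> {}\<close> by (cases "U j = {}") blast+
    then have "contraction j h c'"
      using h by (auto simp: contraction_def)
    then show ?thesis by blast
  qed
  then obtain h c where hc: "\<And>j. j < m \<Longrightarrow> contraction j (h j) (c j)" by metis
  have c: "c j \<in> topspace ?Z"
    and h: "continuous_map (prod_topology (top_of_set {0..1::real}) (subtopology ?Z (U j))) ?Z (h j)"
    and h0: "h j (0, x) = x" and h1: "x \<in> U j \<Longrightarrow> h j (1, x) = c j" if "j < m" for j x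
    using hc[OF that] by (simp_all add: contraction_def)
  define g where "g = (\<lambda>j v. if v \<in> Q j then h j (\<tau> j v, \<theta> v) else \<theta> v)"
  have g_\<theta>: "g j v = \<theta> v" if "j < m" "\<tau> j v = 0" for j v
    using that h0 by (simp add: g_def)
  have hQ: "continuous_map (top_of_set (Q j)) ?Z (\<lambda>v. h j (\<tau> j v, \<theta> v))" if "j < m" for j
  proof -
    have "Q j \<subseteq> P" by (auto simp: Q_def)
    have "continuous_map (top_of_set (Q j)) (prod_topology (top_of_set {0..1}) (subtopology ?Z (U j)))
        (\<lambda>v. (\<tau> j v, \<theta> v))"
    proof (intro continuous_map_pairedI)
      show "continuous_map (top_of_set (Q j)) (top_of_set {0..1}) (\<tau> j)"
        using continuous_on_subset[OF \<tau>_cont \<open>Q j \<subseteq> P\<close>] \<tau>01 by (auto simp: continuous_map_in_subtopology)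
      show "continuous_map (top_of_set (Q j)) (subtopology ?Z (U j)) \<theta>"
        using continuous_map_from_subtopology_mono[OF \<theta>_cont \<open>Q j \<subseteq> P\<close>]
        by (auto simp: continuous_map_in_subtopology Q_def)
    qed
    from continuous_map_compose[OF this h[OF that]] show ?thesis by (simp add: o_def)
  qed
  have g_in: "g j v \<in> topspace ?Z" if "j < m" "v \<in> P" for j v
    using continuous_map_image_subset_topspace[OF hQ[OF that(1)]] \<theta>_in[OF that(2)]
    by (auto simp: g_def)
  have g_cont: "continuous_on P (\<lambda>v. g j v i)" if "j < m" "i \<in> V" for i j
  proof -
    \<comment> \<open>On \<open>R\<close> the cutoff is 0 and \<open>g j\<close> is
      \<open>\<theta>\<close>. The open sets \<open>Q j\<close> and \<open>R\<close> cover
      \<open>P\<close>, because \<open>d j\<close> vanishes off \<open>Q j\<close>, and the two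
      formulas for \<open>g j\<close> glue.\<close>
    define R where "R = P \<inter> {v. 2 * m * d j v < D v}"
    have "open R"
      unfolding R_def using \<open>open P\<close>
      by (intro open_Int open_Collect_less continuous_intros d_cont D_cont) auto
    have "continuous_on (Q j) (\<lambda>v. h j (\<tau> j v, \<theta> v) i)"
      using hQ[OF that(1)] that(2) by (auto simp: continuous_map_into_moment_angle_complex)
    then have 1: "continuous_on (Q j) (\<lambda>v. g j v i)"
      by (rule continuous_on_eq) (simp add: g_def)
    have "continuous_on P (\<lambda>v. \<theta> v i)"
      using \<theta>_cont that(2) by (auto simp: continuous_map_into_moment_angle_complex)
    then have "continuous_on R (\<lambda>v. \<theta> v i)"
      by (rule continuous_on_subset) (auto simp: R_def)
    then have 2: "continuous_on R (\<lambda>v. g j v i)"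
    proof (rule continuous_on_eq)
      fix v assume "v \<in> R"
      then have "\<mu> j v = 0" using D_pos[of v] by (auto simp: R_def \<mu>_def)
      then show "\<theta> v i = g j v i" using g_\<theta>[OF that(1)] by (simp add: \<tau>_def)
    qed
    have "P = Q j \<union> R"
    proof
      have "v \<in> R" if "v \<in> P" "v \<notin> Q j" for v
        using d_pos[OF \<open>j < m\<close>, of v] d_nonneg[of j v] D_pos[OF that(1)] that by (auto simp: R_def)
      then show "P \<subseteq> Q j \<union> R" by auto
    qed (auto simp: Q_def R_def)
    then show ?thesis
      using continuous_on_open_Un[OF Q_open[OF that(1)] \<open>open R\<close> 1 2] by simp
  qed
  \<comment> \<open>All contractions run at the same time, but only block \<open>j\<close> of the
    result of the \<open>j\<close>-th one is kept, with its old radius. Since \<open>B j\<close> is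
    not a face, that block of \<open>g j v\<close> has maximum norm 1, so \<open>G\<close> preserves
    every radius.\<close>
  define G :: "complex^'v \<Rightarrow> complex^'v" where
    "G = (\<lambda>v. \<chi> i. if i \<in> W \<and> v \<in> P then r (b i) v *\<^sub>R g (b i) v i else v $ i)"
  have G_id: "G v = v" if "s v = 0" for v
    using that WE r\<theta> g_\<theta> by (auto simp: G_def vec_eq_iff \<tau>_def)
  have G_r: "r j (G v) = r j v" if "v \<in> P" "j < m" for v j
  proof (rule r_eqI[OF that(2)])
    have eq: "norm (G v $ i) = r j v * norm (g j v i)" if "i \<in> B j" for i
      using that b_eq[OF \<open>j < m\<close> that] \<open>j < m\<close> \<open>v \<in> P\<close> by (auto simp: G_def W_def P_def)
    show "norm (G v $ i) \<le> r j v" if "i \<in> B j" for i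
      using eq[OF that] moment_angle_complex_norm_le[OF g_in[OF \<open>j < m\<close> \<open>v \<in> P\<close>], of i]
        B(2)[OF \<open>j < m\<close>] that \<open>v \<in> P\<close> \<open>j < m\<close> by (auto simp: P_def mult_left_le)
    show "\<exists>i\<in>B j. norm (G v $ i) = r j v"
      using moment_angle_complex_nonface[OF g_in[OF \<open>j < m\<close> \<open>v \<in> P\<close>] B(2)[OF \<open>j < m\<close>]]
        nonface[OF \<open>j < m\<close>] eq by fastforce
  qed
  have "surj G"
  proof (rule bounded_displacement_surjective)
    have "continuous_on P G"
      unfolding G_def
    proof (rule continuous_on_vec_lambda)
      fix i
      show "continuous_on P (\<lambda>v. if i \<in> W \<and> v \<in> P then r (b i) v *\<^sub>R g (b i) v i else v $ i)"
      proof (cases "i \<in> W")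
        case True
        then have "continuous_on P (\<lambda>v. r (b i) v *\<^sub>R g (b i) v i)"
          using WE WV by (intro continuous_intros r_cont g_cont) auto
        then show ?thesis by (rule continuous_on_eq) (use True in simp)
      qed (simp add: continuous_intros)
    qed
    \<comment> \<open>An open neighbourhood of the complement of \<open>P\<close> on which
      \<open>G\<close> is the identity.\<close>
    moreover define N where "N = (\<Union>j<m. {v. r j v < 1/4})"
    moreover have "continuous_on N G"
    proof (rule continuous_on_eq[OF continuous_on_id])
      show "v = G v" if "v \<in> N" for v
        using that G_id[OF s_0] by (force simp: N_def)
    qed
    moreover have "open N"
      unfolding N_def using r_cont by (intro open_UN ballI open_Collect_less continuous_intros) auto
    ultimately have "continuous_on (P \<union> N) G"
      using \<open>open P\<close> by (intro continuous_on_open_Un)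
    moreover have "P \<union> N = UNIV"
      by (force simp: P_def N_def)
    ultimately show "continuous_on UNIV G" by simp
    show "norm (v - G v) \<le> (\<Sum>i\<in>(UNIV::'v set). 2)" for v
    proof (cases "s v = 0")
      case True
      then show ?thesis by (simp add: G_id)
    next
      case False
      have "norm ((v - G v) $ i) \<le> 2" for i
      proof (cases "i \<in> W \<and> v \<in> P")
        case True
        then have i: "b i < m" "i \<in> B (b i)" using WE by auto
        have r1: "r (b i) v < 1" using s_0[OF i(1), of v] False by fastforce
        have "norm (v $ i) \<le> 1" "norm (G v $ i) \<le> 1"
          using r_ge[OF i(2), of v] r_ge[OF i(2), of "G v"] G_r[of v "b i"] True i r1 by auto
        then show ?thesis
          using norm_triangle_ineq4[of "v $ i" "G v $ i"] by simp
      qed (auto simp: G_def)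
      then have "(\<Sum>i\<in>UNIV. norm ((v - G v) $ i)) \<le> (\<Sum>i\<in>(UNIV::'v set). 2)"
        by (intro sum_mono)
      moreover have "norm (v - G v) \<le> (\<Sum>i\<in>UNIV. norm ((v - G v) $ i))"
        unfolding norm_vec_def by (intro L2_set_le_sum) auto
      ultimately show ?thesis by (rule order_trans[rotated])
    qed
  qed
  \<comment> \<open>The missed point: every radius is 1/2 and block \<open>j\<close> is antipodal to
    the endpoint \<open>c j\<close>. A preimage also has all radii 1/2, so some contraction is
    complete there, and block \<open>j\<close> of its image is half of \<open>c j\<close> instead of
    minus half.\<close>
  define y :: "complex^'v" where "y = (\<chi> i. if i \<in> W then - (c (b i) i / 2) else 0)"
  obtain v where v: "G v = y" using \<open>surj G\<close> by (metis surjD)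
  have y_eq: "y $ i = - (c j i / 2)" if "j < m" "i \<in> B j" for i j
    using that b_eq[OF that] by (auto simp: y_def W_def)
  have c_norm: "\<exists>i\<in>B j. norm (c j i) = 1" if "j < m" for j
    using moment_angle_complex_nonface[OF c[OF that] B(2)[OF that]] nonface[OF that] by blast
  have ry: "r j y = 1/2" if "j < m" for j
  proof (rule r_eqI[OF that])
    show "norm (y $ i) \<le> 1/2" if "i \<in> B j" for i
      using y_eq[OF \<open>j < m\<close> that] moment_angle_complex_norm_le[OF c[OF \<open>j < m\<close>], of i] that
        B(2)[OF \<open>j < m\<close>] by (auto simp: norm_divide)
    show "\<exists>i\<in>B j. norm (y $ i) = 1/2"
      using c_norm[OF that] y_eq[OF that] by (fastforce simp: norm_divide)
  qed
  have "v \<in> P"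
  proof (rule ccontr)
    assume "v \<notin> P"
    then have "G v = v" by (simp add: G_def vec_eq_iff)
    with v have "v = y" by simp
    obtain j where "j < m" "\<not> 0 < r j v" using \<open>v \<notin> P\<close> by (auto simp: P_def)
    with ry[of j] \<open>v = y\<close> show False by simp
  qed
  have rv: "r j v = 1/2" if "j < m" for j
    using G_r[OF \<open>v \<in> P\<close> that] ry[OF that] v by simp
  have "s v = 1" unfolding s_def by (intro prod.neutral ballI) (simp add: rv)
  obtain j where j: "j < m" "\<mu> j v = 1" using \<mu>_one[OF \<open>v \<in> P\<close>] by blast
  then have "0 < d j v" using d_nonneg[of j v] by (cases "d j v = 0") (auto simp: \<mu>_def)
  then have "v \<in> Q j" using d_pos[OF j(1)] by blast
  then have g: "g j v = c j"
    using h1[OF j(1)] \<open>s v = 1\<close> j(2) by (auto simp: g_def \<tau>_def Q_def)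
  obtain i where i: "i \<in> B j" "norm (c j i) = 1" using c_norm[OF j(1)] by blast
  have "y $ i = (1/2) *\<^sub>R c j i"
    using v[symmetric] b_eq[OF j(1) i(1)] i(1) j(1) \<open>v \<in> P\<close> g rv[OF j(1)]
    by (auto simp: G_def W_def)
  with y_eq[OF j(1) i(1)] have "c j i = 0" by (simp add: scaleR_conv_of_real)
  with i(2) show False by simp
qed

subsection \<open>Independent lines\<close>

lemma lines_eq: "lines = {vec.span {b} |b. b \<noteq> (0 :: 'k::field ^ 'n)}"
proof (intro equalityI subsetI)
  fix l :: "('k ^ 'n) set"
  assume "l \<in> lines"
  then have l: "vec.subspace l" "vec.dim l = 1" by (auto simp: lines_def)
  obtain B where B: "B \<subseteq> l" "vec.independent B" "l \<subseteq> vec.span B" "card B = vec.dim l"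
    using vec.basis_exists by blast
  then obtain b where b: "B = {b}" using l(2) by (metis card_1_singletonE)
  then have "vec.span {b} = l" using vec.span_subspace[OF B(1) B(3) l(1)] by simp
  moreover have "b \<noteq> 0" using B(2) b by simp
  ultimately show "l \<in> {vec.span {b} |b. b \<noteq> 0}" by blast
next
  fix l :: "('k ^ 'n) set"
  assume "l \<in> {vec.span {b} |b. b \<noteq> 0}"
  then obtain b where "l = vec.span {b}" "b \<noteq> 0" by auto
  moreover have "vec.dim (vec.span {b}) = card {b}"
    using \<open>b \<noteq> 0\<close> by (intro vec.dim_span_eq_card_independent) simp
  ultimately show "l \<in> lines" by (simp add: lines_def)
qed

lemma span_UN_singleton: "vec.span (\<Union>b\<in>S. vec.span {b}) = vec.span S"
proof
  have "vec.span {b} \<subseteq> vec.span S" if "b \<in> S" for b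
    using that by (intro vec.span_mono) simp
  then show "vec.span (\<Union>b\<in>S. vec.span {b}) \<subseteq> vec.span S"
    by (intro vec.span_minimal vec.subspace_span) auto
  show "vec.span S \<subseteq> vec.span (\<Union>b\<in>S. vec.span {b})"
    by (intro vec.span_mono) (auto intro: vec.span_base)
qed

lemma line_complexI:
  fixes S :: "('k::field ^ 'n) set"
  assumes "vec.independent S"
  shows "(\<lambda>b. vec.span {b}) ` S \<in> line_complex"
proof -
  have "finite S" using assms by (rule vec.finiteI_independent)
  have "inj_on (\<lambda>b. vec.span {b}) S"
  proof (rule inj_onI, rule ccontr)
    fix a b assume ab: "a \<in> S" "b \<in> S" "vec.span {a} = vec.span {b}" "a \<noteq> b"
    have "a \<in> vec.span {b}" using ab(3) vec.span_base[of a "{a}"] by simp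
    also have "\<dots> \<subseteq> vec.span (S - {a})" using ab by (intro vec.span_mono) auto
    finally show False using assms ab(1) by (auto simp: vec.dependent_def)
  qed
  then have "card ((\<lambda>b. vec.span {b}) ` S) = card S" by (rule card_image)
  moreover have "b \<noteq> 0" if "b \<in> S" for b
    using assms vec.dependent_zero that by blast
  ultimately show ?thesis
    using \<open>finite S\<close> assms
    by (auto simp: line_complex_def lines_eq span_UN_singleton vec.dim_eq_card_independent
        simp del: vec.dim_span intro!: vec.dim_span_eq_card_independent)
qed

text \<open>Distinct lines are independent, since an inclusion between subspaces of equal dimension
  is an equality. This is the hypothesis on pairs in the upper bound.\<close>

lemma line_complex_pair:
  fixes \<sigma> :: "('k::field ^ 'n) set set"
  assumes "\<sigma> \<subseteq> lines" "finite \<sigma>" "card \<sigma> \<le> 2"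
  shows "\<sigma> \<in> line_complex"
proof -
  from assms(3) consider "card \<sigma> = 0" | "card \<sigma> = 1" | "card \<sigma> = 2" by linarith
  then show ?thesis
  proof cases
    case 1
    then have "\<sigma> = {}" using assms by simp
    then show ?thesis by (simp add: line_complex_def)
  next
    case 2
    then obtain l where "\<sigma> = {l}" by (metis card_1_singletonE)
    then obtain a where "\<sigma> = (\<lambda>b. vec.span {b}) ` {a}" "a \<noteq> 0"
      using assms by (auto simp: lines_eq)
    then show ?thesis by (metis line_complexI vec.dependent_single)
  next
    case 3
    then obtain k l where "\<sigma> = {k, l}" "k \<noteq> l" by (auto simp: card_2_iff)
    then obtain a b where ab: "\<sigma> = (\<lambda>b. vec.span {b}) ` {a, b}"
      "a \<noteq> 0" "b \<noteq> 0" "vec.span {a} \<noteq> vec.span {b}"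
      using assms by (auto simp: lines_eq)
    have "a \<notin> vec.span {b}"
    proof
      assume "a \<in> vec.span {b}"
      then have "vec.span {a} \<subseteq> vec.span {b}" by (intro vec.span_minimal) auto
      moreover have "vec.span {a} \<in> lines" "vec.span {b} \<in> lines" using ab by (auto simp: lines_eq)
      ultimately have "vec.span {a} = vec.span {b}"
        by (intro vec.subspace_dim_equal) (auto simp: lines_def simp del: vec.dim_span)
      with ab show False by simp
    qed
    then have "vec.independent {a, b}" using ab by (simp add: vec.independent_insert)
    then show ?thesis unfolding ab(1) by (rule line_complexI)
  qed
qed

text \<open>A basis of the span of \<open>\<Union>B\<close> and one generator for each remaining
  line span everything that \<open>\<sigma>\<close> spans, and that dimension is
  \<open>card \<sigma>\<close>. The purpose is to exclude three lines of one plane from a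
  simplex.\<close>

lemma line_complex_card_le_dim:
  fixes \<sigma> :: "('k::field ^ 'n) set set"
  assumes "\<sigma> \<in> line_complex" "B \<subseteq> \<sigma>"
  shows "card B \<le> vec.dim (\<Union>B)"
proof -
  from assms(1) have \<sigma>: "\<sigma> \<subseteq> lines" "finite \<sigma>" "vec.dim (\<Union>\<sigma>) = card \<sigma>"
    by (auto simp: line_complex_def)
  obtain C where C: "vec.independent C" "\<Union>B \<subseteq> vec.span C" "card C = vec.dim (\<Union>B)"
    using vec.basis_exists[of "\<Union>B"] by metis
  have "finite C" using C(1) by (rule vec.finiteI_independent)
  have "\<forall>l\<in>\<sigma>. \<exists>b. l = vec.span {b}" using \<sigma> by (auto simp: lines_eq)
  then obtain f where f: "\<And>l. l \<in> \<sigma> \<Longrightarrow> l = vec.span {f l}" by metis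
  have "l \<subseteq> vec.span (C \<union> f ` (\<sigma> - B))" if "l \<in> \<sigma>" for l
  proof (cases "l \<in> B")
    case True
    then have "l \<subseteq> vec.span C" using C by auto
    also have "\<dots> \<subseteq> vec.span (C \<union> f ` (\<sigma> - B))" by (intro vec.span_mono) auto
    finally show ?thesis .
  next
    case False
    have "vec.span {f l} \<subseteq> vec.span (C \<union> f ` (\<sigma> - B))"
      using False that by (intro vec.span_mono) auto
    then show ?thesis using f[OF that] by simp
  qed
  then have "vec.dim (\<Union>\<sigma>) \<le> card (C \<union> f ` (\<sigma> - B))"
    using \<sigma> \<open>finite C\<close> by (intro vec.dim_le_card) auto
  also have "\<dots> \<le> card C + card (\<sigma> - B)"
    using card_Un_le[of C "f ` (\<sigma> - B)"] card_image_le[of "\<sigma> - B" f] \<sigma>(2) by simp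
  also have "card (\<sigma> - B) = card \<sigma> - card B"
    using assms(2) \<sigma>(2) by (meson card_Diff_subset finite_subset)
  finally show ?thesis
    using \<sigma>(3) C(3) card_mono[OF \<sigma>(2) assms(2)] by simp
qed

lemma span_singleton_zero_iff:
  fixes x y :: "'k::field ^ 'n"
  assumes "vec.span {x} = vec.span {y}"
  shows "x $ i = 0 \<longleftrightarrow> y $ i = 0"
proof -
  have "x \<in> vec.span {y}" "y \<in> vec.span {x}"
    using assms vec.span_base[of x "{x}"] vec.span_base[of y "{y}"] by auto
  then show ?thesis by (auto simp: vec.span_singleton)
qed

text \<open>The axes are grouped in pairs, and the triple of a coordinate plane consists of the
  lines through \<open>u\<close>, \<open>w\<close> and \<open>u + w\<close>. These are distinct over
  every field; over the field with two elements they are all the lines of the plane.\<close>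

lemma line_complex_triples:
  fixes n m :: nat
  assumes "CARD('n::finite) = n" "2 * m \<le> n"
  obtains B :: "nat \<Rightarrow> ('k::field ^ 'n) set set" where
    "\<And>j. j < m \<Longrightarrow> B j \<noteq> {}" "\<And>j. j < m \<Longrightarrow> B j \<subseteq> lines"
    "\<And>i j. i < m \<Longrightarrow> j < m \<Longrightarrow> i \<noteq> j \<Longrightarrow> B i \<inter> B j = {}"
    "\<And>j \<sigma>. j < m \<Longrightarrow> \<sigma> \<in> line_complex \<Longrightarrow> \<not> B j \<subseteq> \<sigma>"
    "\<And>\<sigma>. \<sigma> \<subseteq> (\<Union>j<m. B j) \<Longrightarrow> (\<And>j. j < m \<Longrightarrow> \<not> B j \<subseteq> \<sigma>) \<Longrightarrow> \<sigma> \<in> line_complex"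
proof -
  obtain e :: "nat \<Rightarrow> 'n" where e: "bij_betw e {0..<n} UNIV"
    using ex_bij_betw_nat_finite[of "UNIV :: 'n set"] assms(1) by auto
  have e_eq: "e i = e j \<longleftrightarrow> i = j" if "i < n" "j < n" for i j
    using e that by (auto simp: bij_betw_def inj_on_def)
  define p q where "p = (\<lambda>j. e (2 * j))" and "q = (\<lambda>j. e (2 * j + 1))"
  have pq: "p i = p j \<longleftrightarrow> i = j" "q i = q j \<longleftrightarrow> i = j" "p i \<noteq> q j" "q i \<noteq> p j" if "i < m" "j < m" for i j
  proof -
    have lt: "2 * i < n" "2 * i + 1 < n" "2 * j < n" "2 * j + 1 < n"
      using that assms(2) by linarith+
    show "p i = p j \<longleftrightarrow> i = j" "q i = q j \<longleftrightarrow> i = j"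
      using lt by (simp_all add: p_def q_def e_eq)
    have "2 * i \<noteq> 2 * j + 1" "2 * i + 1 \<noteq> 2 * j" by presburger+
    then show "p i \<noteq> q j" "q i \<noteq> p j"
      unfolding p_def q_def using lt e_eq by blast+
  qed
  define u :: "nat \<Rightarrow> 'k ^ 'n" where "u = (\<lambda>j. axis (p j) 1)"
  define w :: "nat \<Rightarrow> 'k ^ 'n" where "w = (\<lambda>j. axis (q j) 1)"
  define T where "T = (\<lambda>j. {u j, w j, u j + w j})"
  define B where "B = (\<lambda>j. (\<lambda>b. vec.span {b}) ` T j)"
  have supp: "{i. u j $ i \<noteq> 0} = {p j}" "{i. w j $ i \<noteq> 0} = {q j}"
      "{i. (u j + w j) $ i \<noteq> 0} = {p j, q j}" if "j < m" for j
    using pq[OF that that] by (auto simp: u_def w_def axis_def)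
  have ne: "u j \<noteq> w j" "u j \<noteq> u j + w j" "w j \<noteq> u j + w j"
    and nz: "0 \<noteq> u j" "0 \<noteq> w j" "0 \<noteq> u j + w j" if "j < m" for j
  proof -
    have "u j $ p j = 1" "w j $ p j = 0" "w j $ q j = 1"
      using pq(3)[OF that that] by (simp_all add: u_def w_def axis_def)
    then have "u j \<noteq> 0" "w j \<noteq> 0" "u j \<noteq> w j" by force+
    moreover have "(u j + w j) $ p j = 1"
      using \<open>u j $ p j = 1\<close> \<open>w j $ p j = 0\<close> by simp
    then have "u j + w j \<noteq> 0" by force
    ultimately show "u j \<noteq> w j" "u j \<noteq> u j + w j" "w j \<noteq> u j + w j"
      "0 \<noteq> u j" "0 \<noteq> w j" "0 \<noteq> u j + w j" by auto
  qed
  have inj: "i = j \<and> x = y"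
    if "i < m" "j < m" "x \<in> T i" "y \<in> T j" "vec.span {x} = vec.span {y}" for i j x y
  proof -
    \<comment> \<open>The support of a generator depends only on its line, and the chosen generators
      have pairwise different supports.\<close>
    have shape: "z = u k \<and> {l. z $ l \<noteq> 0} = {p k} \<or> z = w k \<and> {l. z $ l \<noteq> 0} = {q k} \<or>
        z = u k + w k \<and> {l. z $ l \<noteq> 0} = {p k, q k}" if "k < m" "z \<in> T k" for k z
      using that(2) supp[OF that(1)] unfolding T_def by blast
    have "{l. x $ l \<noteq> 0} = {l. y $ l \<noteq> 0}"
      using span_singleton_zero_iff[OF that(5)] by simp
    then show ?thesis
      using shape[OF that(1,3)] shape[OF that(2,4)] pq[OF that(1) that(2)] pq(3)[OF that(1) that(1)]
        pq(3)[OF that(2) that(2)]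
      by (elim disjE conjE) (simp_all add: doubleton_eq_iff)
  qed
  show ?thesis
  proof
    show "B j \<noteq> {}" for j by (simp add: B_def T_def)
    show "B j \<subseteq> lines" if "j < m" for j
    proof -
      have "0 \<notin> T j" using nz[OF that] by (auto simp: T_def)
      then show ?thesis unfolding B_def lines_eq by blast
    qed
    show "B i \<inter> B j = {}" if "i < m" "j < m" "i \<noteq> j" for i j
      using inj[OF that(1,2)] that(3) unfolding B_def by blast
    show "\<not> B j \<subseteq> \<sigma>" if "j < m" "\<sigma> \<in> line_complex" for j \<sigma>
    proof
      assume "B j \<subseteq> \<sigma>"
      then have "card (B j) \<le> vec.dim (\<Union>(B j))"
        by (rule line_complex_card_le_dim[OF that(2)])
      also have "\<dots> = vec.dim (vec.span (T j))"
        by (metis B_def span_UN_singleton vec.dim_span)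
      also have "\<dots> \<le> card {u j, w j}"
      proof (rule vec.dim_le_card)
        show "vec.span (T j) \<subseteq> vec.span {u j, w j}"
          by (intro vec.span_minimal) (auto simp: T_def intro: vec.span_base vec.span_add)
      qed simp
      also have "\<dots> \<le> 2" by (simp add: card_insert_if)
      finally have "card (B j) \<le> 2" .
      moreover have "card (B j) = card (T j)"
        unfolding B_def using inj[OF that(1) that(1)] by (intro card_image inj_onI) blast
      moreover have "card (T j) = 3"
        using ne[OF that(1)] by (simp add: T_def)
      ultimately show False by simp
    qed
    fix \<sigma> assume \<sigma>: "\<sigma> \<subseteq> (\<Union>j<m. B j)" and nB: "\<And>j. j < m \<Longrightarrow> \<not> B j \<subseteq> \<sigma>"
    have "\<forall>j. \<exists>t. j < m \<longrightarrow> t \<in> T j \<and> vec.span {t} \<notin> \<sigma>"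
      using nB unfolding B_def by blast
    then obtain t where "\<forall>j. j < m \<longrightarrow> t j \<in> T j \<and> vec.span {t j} \<notin> \<sigma>"
      by (rule choice[THEN exE])
    then have t: "t j \<in> T j" "vec.span {t j} \<notin> \<sigma>" if "j < m" for j
      using that by blast+
    define R :: "('k ^ 'n) set" where "R = (\<lambda>i. axis (e i) 1) ` {2 * m..<n}"
    define S where "S = (\<Union>j<m. T j - {t j}) \<union> R"
    have "finite S" by (simp add: S_def R_def T_def)
    have "card S \<le> (\<Sum>j<m. card (T j - {t j})) + card R"
      unfolding S_def by (intro order_trans[OF card_Un_le] add_right_mono card_UN_le) auto
    also have "\<dots> \<le> (\<Sum>j<m. 2) + (n - 2 * m)"
    proof (intro add_mono sum_mono)
      show "card R \<le> n - 2 * m"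
        unfolding R_def using card_image_le[of "{2 * m..<n}"] by fastforce
      show "card (T j - {t j}) \<le> 2" if "j \<in> {..<m}" for j
      proof -
        have "card (T j) \<le> 3" by (simp add: T_def card_insert_if)
        then show ?thesis using t(1)[of j] that by (simp add: card_Diff_singleton T_def)
      qed
    qed
    also have "\<dots> = n" using assms(2) by simp
    finally have "card S \<le> n" .
    have uw: "u j \<in> vec.span S \<and> w j \<in> vec.span S" if "j < m" for j
    proof -
      have sub: "T j - {t j} \<subseteq> vec.span S"
        using that by (auto simp: S_def intro!: vec.span_base)
      consider "t j = u j" | "t j = w j" | "t j = u j + w j"
        using t(1)[OF \<open>j < m\<close>] unfolding T_def by blast
      then show ?thesis
      proof cases
        case 1
        then have "{w j, u j + w j} \<subseteq> T j - {t j}"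
          using ne[OF \<open>j < m\<close>] by (simp add: T_def)
        then have "w j \<in> vec.span S" "u j + w j \<in> vec.span S" using sub by blast+
        then show ?thesis using vec.span_diff[of "u j + w j" S "w j"] by simp
      next
        case 2
        then have "{u j, u j + w j} \<subseteq> T j - {t j}"
          using ne[OF \<open>j < m\<close>] by (simp add: T_def)
        then have "u j \<in> vec.span S" "u j + w j \<in> vec.span S" using sub by blast+
        then show ?thesis using vec.span_diff[of "u j + w j" S "u j"] by simp
      next
        case 3
        then have "{u j, w j} \<subseteq> T j - {t j}"
          using ne[OF \<open>j < m\<close>] by (simp add: T_def)
        then show ?thesis using sub by blast
      qed
    qed
    have "axis (e i) 1 \<in> vec.span S" if "i < n" for i
    proof (cases "i < 2 * m")
      case True
      then have "i div 2 < m" by linarith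
      moreover have "axis (e i) 1 = u (i div 2) \<or> axis (e i) 1 = w (i div 2)"
      proof (cases "even i")
        case True
        then have "2 * (i div 2) = i" by simp
        then show ?thesis by (simp add: u_def p_def)
      next
        case False
        then have "2 * (i div 2) + 1 = i" by simp
        then show ?thesis by (simp only: w_def q_def) simp
      qed
      ultimately show ?thesis using uw by metis
    next
      case False
      then show ?thesis using that by (auto simp: S_def R_def intro!: vec.span_base)
    qed
    moreover have "\<exists>i<n. e i = k" for k
    proof -
      have "k \<in> e ` {0..<n}" using e by (simp add: bij_betw_def)
      then show ?thesis by auto
    qed
    ultimately have "axis k 1 \<in> vec.span S" for k by metis
    then have "cart_basis \<subseteq> vec.span S"
      by (auto simp: cart_basis_def)
    then have "UNIV \<subseteq> vec.span S"
      using vec.span_minimal[of cart_basis "vec.span S"] by (simp add: span_cart_basis)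
    moreover have "vec.dim (UNIV :: ('k ^ 'n) set) = n"
      using assms(1) by (simp add: card_cart_basis)
    ultimately have "vec.independent S"
      using \<open>card S \<le> n\<close> \<open>finite S\<close> by (intro vec.card_le_dim_spanning[of S UNIV]) simp_all
    then have "vec.independent {b \<in> S. vec.span {b} \<in> \<sigma>}"
      by (rule vec.independent_mono) auto
    then have "(\<lambda>b. vec.span {b}) ` {b \<in> S. vec.span {b} \<in> \<sigma>} \<in> line_complex"
      by (rule line_complexI)
    also have "(\<lambda>b. vec.span {b}) ` {b \<in> S. vec.span {b} \<in> \<sigma>} = \<sigma>"
    proof
      show "\<sigma> \<subseteq> (\<lambda>b. vec.span {b}) ` {b \<in> S. vec.span {b} \<in> \<sigma>}"
      proof
        fix l assume "l \<in> \<sigma>"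
        then obtain j b where "j < m" "b \<in> T j" "l = vec.span {b}" using \<sigma> by (auto simp: B_def)
        moreover from this have "b \<noteq> t j" using t(2) \<open>l \<in> \<sigma>\<close> by blast
        ultimately show "l \<in> (\<lambda>b. vec.span {b}) ` {b \<in> S. vec.span {b} \<in> \<sigma>}"
          using \<open>l \<in> \<sigma>\<close> by (auto simp: S_def)
      qed
    qed auto
    finally show "\<sigma> \<in> line_complex" .
  qed
qed

section \<open>The category for the complex of lines, from both bounds\<close>

theorem theorem4p6:
  fixes n p :: nat
  assumes "n \<ge> 1" and "prime p"
    and "CARD('n::finite) = n" and "CARD('p::prime_card) = p"
  shows "LS_cat (moment_angle_complex (lines :: ('p mod_ring ^ 'n) set set) line_complex)
           = enat (n div 2)"
proof (rule antisym)
  let ?V = "lines :: ('p mod_ring ^ 'n) set set"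
  let ?Z = "moment_angle_complex ?V line_complex"
  have "card \<sigma> \<le> n" if "\<sigma> \<in> line_complex" for \<sigma> :: "('p mod_ring ^ 'n) set set"
    using that vec.dim_subset[OF subset_UNIV[of "\<Union>\<sigma>"]] assms(3)
    by (simp add: line_complex_def card_cart_basis)
  then show "LS_cat ?Z \<le> enat (n div 2)"
    by (intro LS_cat_moment_angle_complex_le line_complex_pair) auto
  show "enat (n div 2) \<le> LS_cat ?Z"
    unfolding LS_cat_def
  proof (rule Inf_greatest, clarify)
    fix k and U :: "nat \<Rightarrow> (('p mod_ring ^ 'n) set \<Rightarrow> complex) set"
    assume U: "\<forall>i\<le>k. openin ?Z (U i) \<and> contractible_in ?Z (U i)"
      and cover: "(\<Union>i\<le>k. U i) = topspace ?Z"
    show "enat (n div 2) \<le> enat k"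
    proof (rule ccontr)
      assume "\<not> enat (n div 2) \<le> enat k"
      \<comment> \<open>The index range up to \<open>k\<close> gives \<open>Suc k\<close> open sets,
        and there is room for exactly as many independent planes as needed, one per set.\<close>
      then have "2 * Suc k \<le> n" by simp
      then show False
      proof (rule line_complex_triples[where 'k = "'p mod_ring", OF assms(3)])
        fix B :: "nat \<Rightarrow> ('p mod_ring ^ 'n) set set"
        assume "\<And>j. j < Suc k \<Longrightarrow> B j \<noteq> {}" "\<And>j. j < Suc k \<Longrightarrow> B j \<subseteq> lines"
          and "\<And>i j. i < Suc k \<Longrightarrow> j < Suc k \<Longrightarrow> i \<noteq> j \<Longrightarrow> B i \<inter> B j = {}"
          and "\<And>j \<sigma>. j < Suc k \<Longrightarrow> \<sigma> \<in> line_complex \<Longrightarrow> \<not> B j \<subseteq> \<sigma>"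
          and "\<And>\<sigma>. \<sigma> \<subseteq> (\<Union>j<Suc k. B j) \<Longrightarrow> (\<And>j. j < Suc k \<Longrightarrow> \<not> B j \<subseteq> \<sigma>) \<Longrightarrow>
            \<sigma> \<in> line_complex"
        then have "(\<Union>j<Suc k. U j) \<noteq> topspace ?Z"
          using U by (intro moment_angle_complex_no_small_cover[of "Suc k" B]) auto
        with cover show False by (simp add: lessThan_Suc_atMost)
      qed
    qed
  qed
qed

end
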